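(* Let $H$ be a $k$-regular bipartite graph of order $m$ with a fixed bipartition $(X,Y)$, and let $H^\tau$ be an orientation of $H$ with skew energy $\mathcal{E}_S(H^\tau)=m\sqrt{k}$. Let $G^\sigma$ be an oriented $l$-regular graph of order $n$ with skew energy $\mathcal{E}_S(G^\sigma)=n\sqrt{l}$. Then $(H^\tau\otimes G^\sigma)^o$ is an oriented $kl$-regular bipartite graph and has the maximum skew energy $\mathcal{E}_S((H^\tau\otimes G^\sigma)^o)=mn\sqrt{kl}$.
   Context: For an oriented graph $D$ on vertices $w_1,\dots,w_N$, its skew-adjacency matrix $S(D)=[s_{ab}]$ has $s_{ab}=1$, $s_{ba}=-1$ if $\langle w_a,w_b\rangle$ is an arc of $D$, and $s_{ab}=s_{ba}=0$ otherwise. The skew energy $\mathcal{E}_S(D)$ is the sum of the absolute values of the eigenvalues of $S(D)$. For any oriented graph of order $N$ and maximum degree $\Delta$ one has $\mathcal{E}_S\le N\sqrt{\Delta}$; the value $N\sqrt{\Delta}$ is called the maximum skew energy. The Kronecker product $H\otimes G$ has vertex set $V(H)\times V(G)$, with $(u_1,v_1)$ adjacent to $(u_2,v_2)$ iff $u_1u_2\in E(H)$ and $v_1v_2\in E(G)$. The orientation $(H^\tau\otimes G^\sigma)^o$ of $H\otimes G$ is defined as follows: for adjacent $(u_1,v_1),(u_2,v_2)$ with $u_1\in X$ (so $u_2\in Y$), there is an arc from $(u_1,v_1)$ to $(u_2,v_2)$ if either ($\langle u_1,u_2\rangle$ is an arc of $H^\tau$ and $\langle v_1,v_2\rangle$ is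 an arc of $G^\sigma$) or ($\langle u_2,u_1\rangle$ is an arc of $H^\tau$ and $\langle v_2,v_1\rangle$ is an arc of $G^\sigma$); otherwise there is an arc from $(u_2,v_2)$ to $(u_1,v_1)$. *)

theory Defs
  imports
    "Graph_Theory.Digraph_Component"
    "Jordan_Normal_Form.Spectral_Radius"
begin

text \<open>Undirected simple graphs are modelled, as in the library, by finite loop-free symmetric
  digraphs (\<^locale>\<open>pair_graph\<close>), so the degree of a vertex is its \<^const>\<open>out_degree\<close>.\<close>

definition oriented_graph :: "'a pair_pre_digraph \<Rightarrow> bool" where
  "oriented_graph D \<longleftrightarrow>
     pair_digraph D \<and> (\<forall>u v. (u, v) \<in> parcs D \<longrightarrow> (v, u) \<notin> parcs D)"

definition orientation_of :: "'a pair_pre_digraph \<Rightarrow> 'a pair_pre_digraph \<Rightarrow> bool" where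
  "orientation_of D G \<longleftrightarrow> oriented_graph D \<and> mk_symmetric (with_proj D) = G"

definition regular_graph :: "nat \<Rightarrow> 'a pair_pre_digraph \<Rightarrow> bool" where
  "regular_graph k G \<longleftrightarrow> (\<forall>v \<in> pverts G. out_degree (with_proj G) v = k)"

definition max_degree :: "'a pair_pre_digraph \<Rightarrow> nat" where
  "max_degree G = Max (out_degree (with_proj G) ` pverts G)"

definition bipartition :: "'a set \<Rightarrow> 'a set \<Rightarrow> 'a pair_pre_digraph \<Rightarrow> bool" where
  "bipartition X Y G \<longleftrightarrow> X \<union> Y = pverts G \<and> X \<inter> Y = {} \<and>
     (\<forall>(u, v) \<in> parcs G. (u \<in> X \<and> v \<in> Y) \<or> (u \<in> Y \<and> v \<in> X))"

definition bipartite_graph :: "'a pair_pre_digraph \<Rightarrow> bool" where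
  "bipartite_graph G \<longleftrightarrow> (\<exists>X Y. bipartition X Y G)"

definition skew_adj_mat :: "'a pair_pre_digraph \<Rightarrow> 'a list \<Rightarrow> complex mat" where
  "skew_adj_mat D ws = mat (length ws) (length ws) (\<lambda>(a, b).
     if (ws ! a, ws ! b) \<in> parcs D then 1
     else if (ws ! b, ws ! a) \<in> parcs D then -1 else 0)"

text \<open>Eigenvalues are counted with algebraic multiplicity.\<close>

definition mat_energy :: "complex mat \<Rightarrow> real" where
  "mat_energy A = (\<Sum>z \<in> spectrum A. real (order z (char_poly A)) * cmod z)"

text \<open>The vertices may be enumerated in any order, see \<open>skew_energy_eq\<close> below.\<close>

definition skew_energy :: "'a pair_pre_digraph \<Rightarrow> real" where
  "skew_energy D = mat_energy (skew_adj_mat D (SOME ws. distinct ws \<and> set ws = pverts D))"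

definition max_skew_energy :: "'a pair_pre_digraph \<Rightarrow> real" where
  "max_skew_energy D =
     real (card (pverts D)) * sqrt (real (max_degree (mk_symmetric (with_proj D))))"

definition kronecker_product ::
    "'a pair_pre_digraph \<Rightarrow> 'b pair_pre_digraph \<Rightarrow> ('a \<times> 'b) pair_pre_digraph" where
  "kronecker_product H G = \<lparr> pverts = pverts H \<times> pverts G,
     parcs = {((u1, v1), (u2, v2)) | u1 v1 u2 v2. (u1, u2) \<in> parcs H \<and> (v1, v2) \<in> parcs G} \<rparr>"

text \<open>Here \<open>X\<close> is the first part of the bipartition of the graph underlying \<open>H\<close>.\<close>

definition kronecker_orientation ::
    "'a set \<Rightarrow> 'a pair_pre_digraph \<Rightarrow> 'b pair_pre_digraph \<Rightarrow> ('a \<times> 'b) pair_pre_digraph" where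
  "kronecker_orientation X H G =
    (let E = parcs (kronecker_product (mk_symmetric (with_proj H)) (mk_symmetric (with_proj G)));
         fwd = (\<lambda>u1 v1 u2 v2. ((u1, u2) \<in> parcs H \<and> (v1, v2) \<in> parcs G) \<or>
                              ((u2, u1) \<in> parcs H \<and> (v2, v1) \<in> parcs G))
     in \<lparr> pverts = pverts H \<times> pverts G,
          parcs = {((u1, v1), (u2, v2)) | u1 v1 u2 v2.
                     ((u1, v1), (u2, v2)) \<in> E \<and> u1 \<in> X \<and> fwd u1 v1 u2 v2} \<union>
                  {((u2, v2), (u1, v1)) | u1 v1 u2 v2.
                     ((u1, v1), (u2, v2)) \<in> E \<and> u1 \<in> X \<and> \<not> fwd u1 v1 u2 v2} \<rparr>)"

lemma char_poly_permute:
  fixes A :: "complex mat"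
  assumes A: "A \<in> carrier_mat n n" and p: "p permutes {0..<n}"
  shows "char_poly (mat n n (\<lambda>(i, j). A $$ (p i, p j))) = char_poly A"
proof -
  let ?C = "char_poly_matrix A"
  let ?R = "mat n n (\<lambda>(i, j). ?C $$ (p i, j))"
  have C: "?C \<in> carrier_mat n n" using A by simp
  have R: "?R \<in> carrier_mat n n" by simp
  have p_less: "p i < n \<longleftrightarrow> i < n" for i
    using permutes_in_image[OF p, of i] by simp
  have p_inj: "p i = p j \<longleftrightarrow> i = j" for i j
    using permutes_inj[OF p] by (auto dest: injD)
  have 1: "char_poly_matrix (mat n n (\<lambda>(i, j). A $$ (p i, p j)))
      = mat n n (\<lambda>(i, j). ?C $$ (p i, p j))"
    using A by (intro eq_matI) (auto simp: char_poly_matrix_def p_less p_inj)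
  have 2: "transpose_mat (mat n n (\<lambda>(i, j). ?C $$ (p i, p j)))
      = mat n n (\<lambda>(i, j). transpose_mat ?R $$ (p i, j))"
    using A by (intro eq_matI) (auto simp: p_less)
  have "det (mat n n (\<lambda>(i, j). ?C $$ (p i, p j)))
      = det (transpose_mat (mat n n (\<lambda>(i, j). ?C $$ (p i, p j))))"
    by (rule det_transpose[symmetric, of _ n]) simp
  also have "\<dots> = signof p * det (transpose_mat ?R)"
    unfolding 2 by (rule det_permute_rows[OF _ p]) simp
  also have "det (transpose_mat ?R) = det ?R" by (rule det_transpose[OF R])
  also have "det ?R = signof p * det ?C" by (rule det_permute_rows[OF C p])
  also have "signof p * (signof p * det ?C) = det ?C"
    by (simp add: sign_def)
  finally show ?thesis unfolding char_poly_def 1 .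
qed

lemma mat_energy_skew_adj_mat_cong:
  assumes "distinct ws" "distinct ws'" "set ws = set ws'"
  shows "mat_energy (skew_adj_mat D ws) = mat_energy (skew_adj_mat D ws')"
proof -
  have "mset ws = mset ws'" using assms by (simp add: set_eq_iff_mset_eq_distinct)
  then obtain p where p: "p permutes {..<length ws'}" and ws: "permute_list p ws' = ws"
    by (rule mset_eq_permutation)
  let ?n = "length ws'"
  let ?A = "skew_adj_mat D ws" and ?B = "skew_adj_mat D ws'"
  have len: "length ws = ?n" using ws by auto
  have p': "p permutes {0..<?n}" using p by (simp add: lessThan_atLeast0)
  have p_less: "p i < ?n \<longleftrightarrow> i < ?n" for i
    using permutes_in_image[OF p, of i] by simp
  have nth: "ws ! i = ws' ! p i" if "i < ?n" for i
    using that p ws permute_list_nth by metis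
  have A: "?A \<in> carrier_mat ?n ?n" and B: "?B \<in> carrier_mat ?n ?n"
    by (simp_all add: skew_adj_mat_def len)
  have "?A = mat ?n ?n (\<lambda>(i, j). ?B $$ (p i, p j))"
    by (intro eq_matI) (auto simp: skew_adj_mat_def len nth p_less)
  then have cp: "char_poly ?A = char_poly ?B"
    using char_poly_permute[OF B p'] by simp
  then have "spectrum ?A = spectrum ?B"
    by (simp add: spectrum_root_char_poly[OF A] spectrum_root_char_poly[OF B])
  with cp show ?thesis by (simp add: mat_energy_def)
qed

lemma skew_energy_eq:
  assumes "distinct ws" "set ws = pverts D"
  shows "skew_energy D = mat_energy (skew_adj_mat D ws)"
proof -
  let ?ws = "SOME ws. distinct ws \<and> set ws = pverts D"
  have "distinct ?ws \<and> set ?ws = pverts D"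
    by (rule someI[of _ ws]) (use assms in simp)
  then show ?thesis
    unfolding skew_energy_def using assms by (intro mat_energy_skew_adj_mat_cong) auto
qed

end

theory Submission
  imports Defs
begin

text \<open>An oriented \<open>d\<close>-regular graph attains the maximum skew energy iff the rows of its
  skew-adjacency matrix are pairwise orthogonal, i.e. \<open>S S\<^sup>T = d I\<close>. The skew-adjacency matrix of
  the orientation of the Kronecker product is \<open>(E S\<^sub>H) \<otimes> S\<^sub>G\<close>, where the diagonal sign matrix \<open>E\<close>
  is \<open>1\<close> on \<open>X\<close> and \<open>-1\<close> on \<open>Y\<close>, and orthogonality of the rows is inherited from both factors.\<close>

section \<open>Traces of matrix powers as power sums of eigenvalues\<close>

definition mat_trace :: "'a::comm_monoid_add mat \<Rightarrow> 'a" where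
  "mat_trace A = (\<Sum>i<dim_row A. A $$ (i, i))"

lemma mat_trace_mult:
  assumes "A \<in> carrier_mat n m" "B \<in> carrier_mat m n"
  shows "mat_trace (A * B) = (\<Sum>i<n. \<Sum>j<m. A $$ (i, j) * B $$ (j, i))"
  using assms by (auto simp: mat_trace_def scalar_prod_def lessThan_atLeast0 intro!: sum.cong)

lemma mat_trace_mult_commute:
  fixes A B :: "'a::comm_semiring_0 mat"
  assumes "A \<in> carrier_mat n m" "B \<in> carrier_mat m n"
  shows "mat_trace (A * B) = mat_trace (B * A)"
  unfolding mat_trace_mult[OF assms] mat_trace_mult[OF assms(2,1)]
  by (subst sum.swap) (simp add: mult.commute)

text \<open>Cyclicity of the trace moves \<open>Q\<close> to the front of \<open>P * B * Q\<close>,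
  where \<open>Q * P\<close> cancels to the identity.\<close>

lemma mat_trace_similar:
  fixes A B :: "'a::comm_ring_1 mat"
  assumes "similar_mat_wit A B P Q"
  shows "mat_trace A = mat_trace B"
proof -
  define n where "n = dim_row A"
  note D = similar_mat_witD[OF n_def assms]
  have "mat_trace A = mat_trace (Q * (P * B))"
    unfolding D(3) by (rule mat_trace_mult_commute[of _ n n]) (use D in auto)
  also have "Q * (P * B) = (Q * P) * B"
    by (rule assoc_mult_mat[symmetric, of _ n n _ n _ n]) (use D in auto)
  also have "\<dots> = B" using D by simp
  finally show ?thesis .
qed

text \<open>In entry \<open>(i, j)\<close> of \<open>B ^\<^sub>m k * B\<close> only the middle
  indices from \<open>i\<close> to \<open>j\<close> can contribute, because both factors are upper
  triangular. Below the diagonal there is no such index, and on the diagonal the only one is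
  \<open>i\<close> itself.\<close>

lemma upper_triangular_pow:
  fixes B :: "'a::comm_ring_1 mat"
  assumes B: "B \<in> carrier_mat n n" "upper_triangular B"
  shows "upper_triangular (B ^\<^sub>m k) \<and> (\<forall>i<n. (B ^\<^sub>m k) $$ (i, i) = (B $$ (i, i)) ^ k)"
proof (induction k)
  case 0
  then show ?case using B by auto
next
  case (Suc k)
  let ?C = "B ^\<^sub>m k"
  have C: "?C \<in> carrier_mat n n" using B by simp
  have entry: "(?C * B) $$ (i, j) = (\<Sum>m\<in>{0..<n}. ?C $$ (i, m) * B $$ (m, j))"
    if "i < n" "j < n" for i j
    using B C that by (simp add: scalar_prod_def)
  have z: "?C $$ (i, m) * B $$ (m, j) = 0"
    if "i < n" "m < n" "m < i \<or> j < m" for i j m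
    using that Suc upper_triangularD[of ?C m i] upper_triangularD[OF B(2), of j m] B by auto
  have "(?C * B) $$ (i, j) = 0" if "j < i" "i < n" for i j
    unfolding entry[OF that(2) less_trans[OF that]]
    by (rule sum.neutral) (use z[of i _ j] that in force)
  moreover have "(?C * B) $$ (i, i) = (B $$ (i, i)) ^ Suc k" if i: "i < n" for i
  proof -
    have "(?C * B) $$ (i, i) = (\<Sum>m\<in>{i}. ?C $$ (i, m) * B $$ (m, i))"
      unfolding entry[OF i i] 
      by (rule sum.mono_neutral_right) (use z[of i _ i] i in \<open>auto simp: neq_iff\<close>)
    then show ?thesis using Suc i by (simp add: mult.commute)
  qed
  ultimately show ?case using B C by (auto intro!: upper_triangularI)
qed

text \<open>A Schur decomposition makes \<open>A\<close> similar to an upper triangular matrix with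
  diagonal \<open>es\<close>. Similarity passes to powers and preserves the trace, and the trace of
  a triangular power can be read off the diagonal.\<close>

lemma mat_trace_pow_eq_sum_eigenvalues:
  fixes A :: "complex mat"
  assumes A: "A \<in> carrier_mat n n" and es: "char_poly A = (\<Prod>e\<leftarrow>es. [:- e, 1:])"
  shows "mat_trace (A ^\<^sub>m k) = (\<Sum>e\<leftarrow>es. e ^ k)"
proof -
  obtain B P Q where "schur_decomposition A es = (B, P, Q)"
    by (cases "schur_decomposition A es") auto
  from schur_decomposition[OF A es this]
  have sim: "similar_mat_wit A B P Q" and tri: "upper_triangular B" and diag: "diag_mat B = es"
    by auto
  have B: "B \<in> carrier_mat n n" using similar_mat_witD2[OF A sim] by simp
  have "mat_trace (A ^\<^sub>m k) = mat_trace (B ^\<^sub>m k)"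
    by (rule mat_trace_similar[OF similar_mat_wit_pow[OF sim]])
  also have "\<dots> = (\<Sum>i<n. (B $$ (i, i)) ^ k)"
    using upper_triangular_pow[OF B tri, of k] B by (simp add: mat_trace_def)
  also have "\<dots> = (\<Sum>e\<leftarrow>diag_mat B. e ^ k)"
    using B by (simp add: diag_mat_def sum_list_sum_nth lessThan_atLeast0)
  finally show ?thesis unfolding diag .
qed

section \<open>Energy as a sum over the list of eigenvalues\<close>

text \<open>Translates algebraic multiplicity, as used in \<open>mat_energy\<close>, into repetition
  in a list of roots.\<close>

lemma order_prod_linear_factors:
  fixes es :: "'a::field list"
  shows "order z (\<Prod>e\<leftarrow>es. [:- e, 1:]) = count_list es z"
proof (induction es)
  case (Cons e es)
  have "(\<Prod>e\<leftarrow>es. [:- e, 1:]) \<noteq> 0" by (auto simp: prod_list_zero_iff)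
  then have "order z ([:- e, 1:] * (\<Prod>e\<leftarrow>es. [:- e, 1:]))
      = order z [:- e, 1:] + order z (\<Prod>e\<leftarrow>es. [:- e, 1:])"
    by (intro order_mult) (simp del: mult_pCons_left)
  with Cons show ?case by (simp add: order_linear' del: mult_pCons_left)
qed simp

text \<open>The index set \<open>S\<close> stays fixed and merely contains the elements of the list,
  so that the induction survives when the tail no longer contains the head. It is applied with
  \<open>S\<close> equal to the spectrum.\<close>

lemma sum_count_list_mult:
  fixes f :: "'a \<Rightarrow> 'b::comm_semiring_1"
  assumes "finite S" "set es \<subseteq> S"
  shows "(\<Sum>z\<in>S. of_nat (count_list es z) * f z) = (\<Sum>e\<leftarrow>es. f e)"
  using assms(2)
proof (induction es)
  case (Cons e es)
  have "(\<Sum>z\<in>S. of_nat (count_list (e # es) z) * f z)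
      = (\<Sum>z\<in>S. (if e = z then f z else 0) + of_nat (count_list es z) * f z)"
    by (rule sum.cong) (auto simp: algebra_simps)
  also have "\<dots> = f e + (\<Sum>e\<leftarrow>es. f e)"
    using Cons assms(1) by (simp add: sum.distrib)
  finally show ?case by simp
qed simp

lemma spectrum_eq_set_roots:
  fixes A :: "complex mat"
  assumes A: "A \<in> carrier_mat n n" and es: "char_poly A = (\<Prod>e\<leftarrow>es. [:- e, 1:])"
  shows "spectrum A = set es"
  unfolding spectrum_root_char_poly[OF A] es
  by (auto simp: poly_prod_list prod_list_zero_iff)

lemma mat_energy_eq_sum_list:
  assumes A: "A \<in> carrier_mat n n" and es: "char_poly A = (\<Prod>e\<leftarrow>es. [:- e, 1:])"
  shows "mat_energy A = (\<Sum>e\<leftarrow>es. cmod e)"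
  unfolding mat_energy_def spectrum_eq_set_roots[OF assms] es order_prod_linear_factors
  by (rule sum_count_list_mult) auto

section \<open>Real skew-symmetric matrices: maximum energy and the square of the matrix\<close>

text \<open>For an eigenvector \<open>v\<close> the form \<open>q\<close>, the value of v* A v,
  equals \<open>z\<close> times the squared norm \<open>r\<close> of \<open>v\<close>. Conjugation
  fixes the real entries of \<open>A\<close>; swapping the two summations and using skew symmetry
  then gives \<open>cnj q = - q\<close>. Hence \<open>z + cnj z\<close> is annihilated by the
  nonzero number \<open>r\<close>.\<close>

lemma eigenvalue_real_skew_imaginary:
  fixes A :: "complex mat"
  assumes A: "A \<in> carrier_mat n n"
    and real: "\<And>i j. i < n \<Longrightarrow> j < n \<Longrightarrow> A $$ (i, j) \<in> \<real>"
    and skew: "\<And>i j. i < n \<Longrightarrow> j < n \<Longrightarrow> A $$ (j, i) = - A $$ (i, j)"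
    and z: "eigenvalue A z"
  shows "Re z = 0"
proof -
  from z obtain v where v: "v \<in> carrier_vec n" "v \<noteq> 0\<^sub>v n" "A *\<^sub>v v = z \<cdot>\<^sub>v v"
    using A by (auto simp: eigenvalue_def eigenvector_def)
  have Av: "(\<Sum>j<n. A $$ (i, j) * v $ j) = z * v $ i" if "i < n" for i
    using arg_cong[OF v(3), of "\<lambda>w. w $ i"] that A v(1)
    by (simp add: scalar_prod_def lessThan_atLeast0)
  define q where "q = (\<Sum>i<n. \<Sum>j<n. cnj (v $ i) * A $$ (i, j) * v $ j)"
  define r where "r = (\<Sum>i<n. (cmod (v $ i))\<^sup>2)"
  have "q = (\<Sum>i<n. cnj (v $ i) * (z * v $ i))"
    unfolding q_def by (rule sum.cong) (simp_all add: Av[symmetric] sum_distrib_left mult.assoc)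
  also have "\<dots> = z * of_real r"
    by (simp add: r_def sum_distrib_left complex_norm_square mult_ac del: of_real_power)
  finally have q: "q = z * of_real r" .
  have "cnj q = (\<Sum>i<n. \<Sum>j<n. v $ i * A $$ (i, j) * cnj (v $ j))"
    unfolding q_def by (auto intro!: sum.cong simp: Reals_cnj_iff[THEN iffD1, OF real])
  also have "\<dots> = (\<Sum>j<n. \<Sum>i<n. v $ i * A $$ (i, j) * cnj (v $ j))"
    by (rule sum.swap)
  also have "\<dots> = - q"
    unfolding q_def sum_negf[symmetric]
  proof (intro sum.cong refl)
    fix i j assume "i \<in> {..<n}" "j \<in> {..<n}"
    then have "A $$ (j, i) = - A $$ (i, j)" by (intro skew) simp_all
    then show "v $ j * A $$ (j, i) * cnj (v $ i) = - (cnj (v $ i) * A $$ (i, j) * v $ j)"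
      by simp
  qed
  finally have "(z + cnj z) * of_real r = 0"
    unfolding q by (simp add: algebra_simps)
  moreover have "r \<noteq> 0"
  proof
    assume "r = 0"
    then have "\<forall>i<n. v $ i = 0"
      unfolding r_def by (subst (asm) sum_nonneg_eq_0_iff) auto
    then show False using v(1,2) by (auto simp: vec_eq_iff)
  qed
  ultimately show ?thesis by (simp add: complex_eq_iff)
qed

text \<open>The variance of the moduli of the eigenvalues vanishes, so that all of them equal
  \<open>\<i> \<surd>d\<close> up to sign. Since \<open>A\<^sup>2 + d\<close> is real and symmetric, the sum of its squared entries is
  \<open>tr ((A\<^sup>2 + d)\<^sup>2) = \<Sum>e. (e\<^sup>2 + d)\<^sup>2 = 0\<close>; this avoids diagonalising \<open>A\<close>.\<close>

lemma square_eq_if_max_energy: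
  fixes A :: "complex mat" and d :: real
  assumes A: "A \<in> carrier_mat n n"
    and real: "\<And>i j. i < n \<Longrightarrow> j < n \<Longrightarrow> A $$ (i, j) \<in> \<real>"
    and skew: "\<And>i j. i < n \<Longrightarrow> j < n \<Longrightarrow> A $$ (j, i) = - A $$ (i, j)"
    and d: "d \<ge> 0" and trace: "mat_trace (A * A) = - of_real (of_nat n * d)"
    and energy: "mat_energy A = of_nat n * sqrt d"
  shows "A * A = - of_real d \<cdot>\<^sub>m 1\<^sub>m n"
proof -
  obtain es where es: "char_poly A = (\<Prod>e\<leftarrow>es. [:- e, 1:])" and len: "length es = n"
    using char_poly_factorized[OF A] by auto
  have Re: "Re e = 0" if "e \<in> set es" for e
    using that eigenvalue_real_skew_imaginary[OF A real skew]
    unfolding spectrum_eq_set_roots[OF A es, symmetric] by (simp add: spectrum_def)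
  \<comment> \<open>Since the eigenvalues are purely imaginary, the trace of \<open>A * A\<close>
    determines the sum of their squared moduli, while the energy gives the sum of the moduli. These
    are the two moments needed for the variance.\<close>
  have sq: "e\<^sup>2 = - of_real ((cmod e)\<^sup>2)" if "e \<in> set es" for e
    using Re[OF that] by (simp add: complex_eq_iff cmod_def power2_eq_square)
  have A2: "A ^\<^sub>m 2 = A * A" and A4: "A ^\<^sub>m 4 = (A * A) * (A * A)"
    using A by (simp_all add: numeral_eq_Suc assoc_mult_mat[of _ n n _ n _ n])
  have "- of_real (of_nat n * d) = (\<Sum>e\<leftarrow>es. e\<^sup>2)"
    using mat_trace_pow_eq_sum_eigenvalues[OF A es, of 2] trace A2 by simp
  also have "\<dots> = (\<Sum>e\<leftarrow>es. - complex_of_real ((cmod e)\<^sup>2))"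
    by (intro arg_cong[of _ _ sum_list] map_cong refl sq)
  also have "\<dots> = - of_real (\<Sum>e\<leftarrow>es. (cmod e)\<^sup>2)"
    by (induction es) auto
  finally have sum_sq: "(\<Sum>e\<leftarrow>es. (cmod e)\<^sup>2) = of_nat n * d"
    by (simp only: neg_equal_iff_equal of_real_eq_iff)
  have sum_cmod: "(\<Sum>e\<leftarrow>es. cmod e) = of_nat n * sqrt d"
    using energy unfolding mat_energy_eq_sum_list[OF A es] .
  have "(\<Sum>e\<leftarrow>es. (cmod e - sqrt d)\<^sup>2)
      = (\<Sum>e\<leftarrow>es. (cmod e)\<^sup>2) - 2 * sqrt d * (\<Sum>e\<leftarrow>es. cmod e) + of_nat (length es) * (sqrt d)\<^sup>2"
    by (induction es) (simp_all add: algebra_simps power2_eq_square)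
  also have "\<dots> = 2 * of_nat n * d - 2 * of_nat n * (sqrt d * sqrt d)"
    unfolding sum_sq sum_cmod len using d by (simp del: real_sqrt_mult_self)
  also have "\<dots> = 0" using d by simp
  finally have "\<forall>e\<in>set es. cmod e = sqrt d"
    by (subst (asm) sum_list_nonneg_eq_0_iff) auto
  then have sq_d: "e\<^sup>2 = - of_real d" if "e \<in> set es" for e
    using sq[OF that] that d by simp
  define M where "M = A * A"
  have M: "M \<in> carrier_mat n n" using A by (simp add: M_def)
  have M_entry: "M $$ (i, j) = (\<Sum>k<n. A $$ (i, k) * A $$ (k, j))" if "i < n" "j < n" for i j
    using A that by (simp add: M_def scalar_prod_def lessThan_atLeast0)
  \<comment> \<open>The two sign changes, one from each skew factor, cancel.\<close>
  have M_sym: "M $$ (j, i) = M $$ (i, j)" if "i < n" "j < n" for i j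
    unfolding M_entry[OF that] M_entry[OF that(2,1)]
  proof (rule sum.cong)
    fix k assume "k \<in> {..<n}"
    then show "A $$ (j, k) * A $$ (k, i) = A $$ (i, k) * A $$ (k, j)"
      using skew[of j k] skew[of i k] that by simp
  qed simp
  have M_real: "M $$ (i, j) \<in> \<real>" if "i < n" "j < n" for i j
    unfolding M_entry[OF that] using real that by auto
  have "mat_trace (M * M) = (\<Sum>e\<leftarrow>es. e ^ 4)"
    using mat_trace_pow_eq_sum_eigenvalues[OF A es, of 4] by (simp add: A4 M_def)
  also have "\<dots> = (\<Sum>e\<leftarrow>es. (of_real d)\<^sup>2)"
  proof (intro arg_cong[of _ _ sum_list] map_cong refl)
    fix e assume "e \<in> set es"
    then have "(e\<^sup>2)\<^sup>2 = (of_real d)\<^sup>2" by (simp add: sq_d)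
    then show "e ^ 4 = (of_real d)\<^sup>2" by simp
  qed
  also have "\<dots> = of_nat n * (of_real d)\<^sup>2" by (simp add: sum_list_triv len)
  finally have "(\<Sum>i<n. \<Sum>j<n. M $$ (i, j) * M $$ (j, i)) = of_nat n * (of_real d)\<^sup>2"
    unfolding mat_trace_mult[OF M M] .
  moreover have "(\<Sum>i<n. \<Sum>j<n. M $$ (i, j) * M $$ (j, i)) = (\<Sum>i<n. \<Sum>j<n. (M $$ (i, j))\<^sup>2)"
    by (intro sum.cong refl) (simp add: M_sym power2_eq_square)
  ultimately have M_sq: "(\<Sum>i<n. \<Sum>j<n. (M $$ (i, j))\<^sup>2) = of_nat n * (of_real d)\<^sup>2" by simp
  have M_diag: "(\<Sum>i<n. M $$ (i, i)) = - of_real (of_nat n * d)"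
    using trace A by (simp add: mat_trace_def M_def)
  define N where "N i j = M $$ (i, j) + (if i = j then of_real d else 0)" for i j
  have "(\<Sum>i<n. \<Sum>j<n. (N i j)\<^sup>2) = (\<Sum>i<n. \<Sum>j<n. (M $$ (i, j))\<^sup>2
      + (if i = j then 2 * of_real d * M $$ (i, i) + (of_real d)\<^sup>2 else 0))"
    by (intro sum.cong refl) (auto simp: N_def power2_eq_square algebra_simps)
  also have "\<dots> = (\<Sum>i<n. \<Sum>j<n. (M $$ (i, j))\<^sup>2)
      + 2 * of_real d * (\<Sum>i<n. M $$ (i, i)) + of_nat n * (of_real d)\<^sup>2"
    by (simp add: sum.distrib sum_distrib_left)
  also have "\<dots> = 0" unfolding M_sq M_diag by (simp add: power2_eq_square)
  \<comment> \<open>Complex squares may cancel each other in a sum. Since each \<open>N i j\<close>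
    is real, passing to real parts gives a vanishing sum of nonnegative reals, so every term is
    zero.\<close>
  finally have "Re (\<Sum>i<n. \<Sum>j<n. (N i j)\<^sup>2) = 0" by simp
  moreover have N_real: "N i j = of_real (Re (N i j))" if "i < n" "j < n" for i j
    using M_real[OF that] by (auto simp: N_def of_real_Re)
  have "(N i j)\<^sup>2 = of_real ((Re (N i j))\<^sup>2)" if "i < n" "j < n" for i j
    by (subst N_real[OF that]) simp
  then have "Re ((N i j)\<^sup>2) = (Re (N i j))\<^sup>2" if "i < n" "j < n" for i j
    using that by simp
  ultimately have "(\<Sum>i<n. \<Sum>j<n. (Re (N i j))\<^sup>2) = 0" by simp
  then have "\<forall>i<n. \<forall>j<n. Re (N i j) = 0"
    by (simp add: sum_nonneg_eq_0_iff sum_nonneg)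
  then have N0: "N i j = 0" if "i < n" "j < n" for i j
    using that by (subst N_real) simp_all
  show ?thesis
  proof (rule eq_matI)
    fix i j assume ij: "i < dim_row (- of_real d \<cdot>\<^sub>m 1\<^sub>m n)" "j < dim_col (- of_real d \<cdot>\<^sub>m 1\<^sub>m n)"
    then show "(A * A) $$ (i, j) = (- of_real d \<cdot>\<^sub>m 1\<^sub>m n) $$ (i, j)"
      using N0[of i j] by (auto simp: N_def M_def[symmetric] add_eq_0_iff)
  qed (use A in auto)
qed

text \<open>Applying \<open>A\<close> twice to an eigenvector for \<open>e\<close> multiplies it by
  \<open>e\<^sup>2\<close>, and by hypothesis also by \<open>- d\<close>. So each of the
  \<open>n\<close> roots, counted with multiplicity, has modulus \<open>sqrt d\<close>.\<close>

lemma energy_eq_if_square_eq: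
  fixes A :: "complex mat" and d :: real
  assumes A: "A \<in> carrier_mat n n" and d: "d \<ge> 0"
    and sq: "A * A = - of_real d \<cdot>\<^sub>m 1\<^sub>m n"
  shows "mat_energy A = of_nat n * sqrt d"
proof -
  obtain es where es: "char_poly A = (\<Prod>e\<leftarrow>es. [:- e, 1:])" and len: "length es = n"
    using char_poly_factorized[OF A] by auto
  have "cmod e = sqrt d" if "e \<in> set es" for e
  proof -
    have "eigenvalue A e"
      using that unfolding spectrum_eq_set_roots[OF A es, symmetric] by (simp add: spectrum_def)
    then obtain v where v: "v \<in> carrier_vec n" "v \<noteq> 0\<^sub>v n" "A *\<^sub>v v = e \<cdot>\<^sub>v v"
      using A by (auto simp: eigenvalue_def eigenvector_def)
    then obtain i where i: "i < n" "v $ i \<noteq> 0" by (auto simp: vec_eq_iff)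
    have "(A * A) *\<^sub>v v = A *\<^sub>v (e \<cdot>\<^sub>v v)"
      using A v by (simp add: assoc_mult_mat_vec[of _ n n _ n])
    also have "\<dots> = e \<cdot>\<^sub>v (e \<cdot>\<^sub>v v)"
      using A v by (simp add: mult_mat_vec)
    finally have "(A * A *\<^sub>v v) $ i = (e \<cdot>\<^sub>v (e \<cdot>\<^sub>v v)) $ i" by simp
    moreover have "row (- of_real d \<cdot>\<^sub>m 1\<^sub>m n) i = - complex_of_real d \<cdot>\<^sub>v unit_vec n i"
      using i by (intro eq_vecI) auto
    then have "(A * A *\<^sub>v v) $ i = - of_real d * v $ i"
      unfolding sq using i v(1) by (simp add: smult_scalar_prod_distrib[of _ n])
    ultimately have "e\<^sup>2 * v $ i = - of_real d * v $ i"
      using i v(1) by (simp add: power2_eq_square)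
    then have "e\<^sup>2 = - of_real d" 
      using i(2) mult_right_cancel by blast
    then have "cmod (e\<^sup>2) = d" using d by simp
    then show ?thesis by (intro real_sqrt_unique[symmetric]) (simp_all add: norm_power)
  qed
  then have "(\<Sum>e\<leftarrow>es. cmod e) = (\<Sum>e\<leftarrow>es. sqrt d)"
    by (intro arg_cong[of _ _ sum_list] map_cong refl)
  then show ?thesis unfolding mat_energy_eq_sum_list[OF A es] by (simp add: sum_list_triv len)
qed


section \<open>Maximum skew energy as orthogonality of rows\<close>

text \<open>Indexing by vertices instead of positions makes row orthogonality independent of the
  enumeration, and lets entries of a product graph factor over pairs of vertices.\<close>

definition skew_entry :: "'a pair_pre_digraph \<Rightarrow> 'a \<Rightarrow> 'a \<Rightarrow> complex" where
  "skew_entry D u v = (if (u, v) \<in> parcs D then 1 else if (v, u) \<in> parcs D then -1 else 0)"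

lemma skew_entry_Reals: "skew_entry D u v \<in> \<real>"
  by (simp add: skew_entry_def)

lemma skew_entry_swap:
  assumes "oriented_graph D"
  shows "skew_entry D v u = - skew_entry D u v"
  using assms by (auto simp: skew_entry_def oriented_graph_def)

lemma skew_adj_mat_carrier: "skew_adj_mat D ws \<in> carrier_mat (length ws) (length ws)"
  by (simp add: skew_adj_mat_def)

lemma skew_adj_mat_index:
  assumes "i < length ws" "j < length ws"
  shows "skew_adj_mat D ws $$ (i, j) = skew_entry D (ws ! i) (ws ! j)"
  using assms by (simp add: skew_adj_mat_def skew_entry_def)

text \<open>This is S S = - S S^T, from skew symmetry of the second factor: the square of the matrix
  records the inner products of its rows.\<close>

lemma skew_adj_mat_square_index:
  assumes "oriented_graph D" "distinct ws" "i < length ws" "j < length ws"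
  shows "(skew_adj_mat D ws * skew_adj_mat D ws) $$ (i, j)
    = - (\<Sum>v\<in>set ws. skew_entry D (ws ! i) v * skew_entry D (ws ! j) v)"
proof -
  have "(skew_adj_mat D ws * skew_adj_mat D ws) $$ (i, j)
      = (\<Sum>k<length ws. skew_entry D (ws ! i) (ws ! k) * skew_entry D (ws ! k) (ws ! j))"
    using assms skew_adj_mat_carrier[of D ws]
    by (simp add: scalar_prod_def lessThan_atLeast0 skew_adj_mat_index)
  also have "\<dots> = (\<Sum>v\<in>set ws. skew_entry D (ws ! i) v * skew_entry D v (ws ! j))"
    using assms(2) by (intro sum.reindex_bij_betw bij_betw_nth) auto
  also have "\<dots> = - (\<Sum>v\<in>set ws. skew_entry D (ws ! i) v * skew_entry D (ws ! j) v)"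
    unfolding sum_negf[symmetric]
    by (intro sum.cong refl) (subst skew_entry_swap[OF assms(1)], simp)
  finally show ?thesis .
qed

lemma orientation_of_pverts:
  assumes "orientation_of D G"
  shows "pverts D = pverts G"
  using assms by (auto simp: orientation_of_def)

lemma parcs_mk_symmetric_with_proj_iff:
  "(u, v) \<in> parcs (mk_symmetric (with_proj D)) \<longleftrightarrow> (u, v) \<in> parcs D \<or> (v, u) \<in> parcs D"
proof -
  have "parcs (mk_symmetric (with_proj D)) = (\<Union>e\<in>parcs D. {(fst e, snd e), (snd e, fst e)})"
    by (simp add: parcs_mk_symmetric)
  then show ?thesis by fastforce
qed

lemma orientation_of_parcs_iff:
  assumes "orientation_of D G"
  shows "(u, v) \<in> parcs G \<longleftrightarrow> (u, v) \<in> parcs D \<or> (v, u) \<in> parcs D"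
  using assms parcs_mk_symmetric_with_proj_iff by (metis orientation_of_def)

lemma orientation_of_wf:
  assumes "orientation_of D G"
  shows "finite (pverts G)" and "(u, v) \<in> parcs G \<Longrightarrow> u \<in> pverts G \<and> v \<in> pverts G \<and> u \<noteq> v"
proof -
  interpret pair_digraph D
    using assms by (simp add: orientation_of_def oriented_graph_def)
  show "finite (pverts G)"
    using pair_finite_verts orientation_of_pverts[OF assms] by simp
  show "u \<in> pverts G \<and> v \<in> pverts G \<and> u \<noteq> v" if "(u, v) \<in> parcs G"
    using that wellformed' pair_no_loops orientation_of_pverts[OF assms]
    unfolding orientation_of_parcs_iff[OF assms] by fastforce
qed

lemma out_degree_eq_card_neighbours:
  assumes "\<And>v. (u, v) \<in> parcs G \<Longrightarrow> v \<in> pverts G"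
  shows "out_degree (with_proj G) u = card {v \<in> pverts G. (u, v) \<in> parcs G}"
proof -
  have "out_arcs (with_proj G) u = Pair u ` {v \<in> pverts G. (u, v) \<in> parcs G}"
    using assms by (auto simp: out_arcs_def)
  then show ?thesis by (simp add: out_degree_def card_image inj_on_def)
qed

text \<open>The entries in the row of \<open>u\<close> are 1 or -1 exactly at the neighbours of
  \<open>u\<close>, so their squares count the neighbours.\<close>

lemma sum_skew_entry_square:
  assumes "orientation_of D G"
  shows "(\<Sum>v\<in>pverts G. skew_entry D u v * skew_entry D u v) = of_nat (out_degree (with_proj G) u)"
proof -
  have "(\<Sum>v\<in>pverts G. skew_entry D u v * skew_entry D u v)
      = (\<Sum>v\<in>pverts G. if (u, v) \<in> parcs G then 1 else 0)"
    by (intro sum.cong refl) (auto simp: skew_entry_def orientation_of_parcs_iff[OF assms])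
  also have "\<dots> = of_nat (card {v \<in> pverts G. (u, v) \<in> parcs G})"
    using orientation_of_wf(1)[OF assms] by (simp add: sum.If_cases Int_def)
  finally show ?thesis
    using out_degree_eq_card_neighbours[of u G] orientation_of_wf(2)[OF assms] by simp
qed

text \<open>Both directions go through \<open>A * A = - d I\<close>, by
  \<open>square_eq_if_max_energy\<close> and \<open>energy_eq_if_square_eq\<close>. The forward
  direction extracts orthogonality from the two factors, the backward one recovers the energy of the
  product.\<close>

lemma skew_energy_max_iff:
  assumes D: "orientation_of D G" and reg: "regular_graph d G"
  shows "skew_energy D = real (card (pverts G)) * sqrt (real d) \<longleftrightarrow>
    (\<forall>u\<in>pverts G. \<forall>w\<in>pverts G.
      (\<Sum>v\<in>pverts G. skew_entry D u v * skew_entry D w v) = (if u = w then of_nat d else 0))"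
    (is "?max \<longleftrightarrow> ?orth")
proof -
  have ori: "oriented_graph D" using D by (simp add: orientation_of_def)
  obtain ws where ws: "distinct ws" "set ws = pverts G"
    using finite_distinct_list[OF orientation_of_wf(1)[OF D]] by auto
  let ?A = "skew_adj_mat D ws" and ?n = "length ws"
  have n: "card (pverts G) = ?n" using ws distinct_card by metis
  have energy: "skew_energy D = mat_energy ?A"
    using ws orientation_of_pverts[OF D] by (intro skew_energy_eq) auto
  note A = skew_adj_mat_carrier[of D ws]
  note sq_index = skew_adj_mat_square_index[OF ori ws(1), unfolded ws(2)]
  \<comment> \<open>Each diagonal entry of the square is the negated degree of a vertex, so
    regularity supplies the trace hypothesis of \<open>square_eq_if_max_energy\<close>.\<close>
  have "mat_trace (?A * ?A) = (\<Sum>i<?n. - of_nat d)"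
    unfolding mat_trace_def
  proof (rule sum.cong)
    fix i assume "i \<in> {..<?n}"
    then have i: "i < ?n" by simp
    then have "out_degree (with_proj G) (ws ! i) = d"
      using reg ws(2) nth_mem[OF i] by (simp add: regular_graph_def)
    then show "(?A * ?A) $$ (i, i) = - of_nat d"
      unfolding sq_index[OF i i] sum_skew_entry_square[OF D] by simp
  qed (use A in auto)
  then have trace: "mat_trace (?A * ?A) = - of_real (of_nat ?n * real d)" by simp
  have "?max \<longleftrightarrow> ?A * ?A = - of_real (real d) \<cdot>\<^sub>m 1\<^sub>m ?n"
  proof
    assume ?max
    show "?A * ?A = - of_real (real d) \<cdot>\<^sub>m 1\<^sub>m ?n"
    proof (rule square_eq_if_max_energy[OF A _ _ _ trace])
      show "?A $$ (i, j) \<in> \<real>" if "i < ?n" "j < ?n" for i j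
        using that by (simp add: skew_adj_mat_index skew_entry_Reals)
      show "?A $$ (j, i) = - ?A $$ (i, j)" if "i < ?n" "j < ?n" for i j
        unfolding skew_adj_mat_index[OF that] skew_adj_mat_index[OF that(2,1)]
        by (rule skew_entry_swap[OF ori])
      show "mat_energy ?A = of_nat ?n * sqrt (real d)"
        using \<open>?max\<close> by (simp add: energy n)
    qed simp
  next
    assume "?A * ?A = - of_real (real d) \<cdot>\<^sub>m 1\<^sub>m ?n"
    then show ?max using energy_eq_if_square_eq[OF A, of "real d"] by (simp add: energy n)
  qed
  also have "\<dots> \<longleftrightarrow> (\<forall>i<?n. \<forall>j<?n. (?A * ?A) $$ (i, j) = (if i = j then - of_nat d else 0))"
    using A by (auto simp: mat_eq_iff)
  \<comment> \<open>As \<open>ws\<close> is distinct, equal positions and equal vertices are the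
    same thing, and the enumeration can be eliminated.\<close>
  also have "\<dots> \<longleftrightarrow> (\<forall>i<?n. \<forall>j<?n.
      (\<Sum>v\<in>pverts G. skew_entry D (ws ! i) v * skew_entry D (ws ! j) v)
        = (if ws ! i = ws ! j then of_nat d else 0))"
    by (intro all_cong) (auto simp: sq_index nth_eq_iff_index_eq[OF ws(1)])
  also have "\<dots> \<longleftrightarrow> ?orth"
    unfolding ws(2)[symmetric] all_set_conv_all_nth by blast
  finally show ?thesis .
qed

section \<open>The Kronecker product and its orientation\<close>

locale oriented_kronecker_product =
  fixes H H\<tau> :: "'a pair_pre_digraph" and G G\<sigma> :: "'b pair_pre_digraph" and X Y :: "'a set"
  assumes H: "orientation_of H\<tau> H" and G: "orientation_of G\<sigma> G" and bip: "bipartition X Y H"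
begin

abbreviation K :: "('a \<times> 'b) pair_pre_digraph" where
  "K \<equiv> kronecker_orientation X H\<tau> G\<sigma>"

lemma pverts_product: "pverts (kronecker_product H G) = pverts H \<times> pverts G"
  by (simp add: kronecker_product_def)

lemma parcs_product_iff:
  "((u1, v1), (u2, v2)) \<in> parcs (kronecker_product H G) \<longleftrightarrow> (u1, u2) \<in> parcs H \<and> (v1, v2) \<in> parcs G"
  by (simp add: kronecker_product_def)

lemma bip_arc: "(u1, u2) \<in> parcs H \<Longrightarrow> u2 \<in> X \<longleftrightarrow> u1 \<notin> X"
  using bip by (fastforce simp: bipartition_def)

text \<open>Merges the two families of arcs in the definition of the orientation. The condition on
  the right of the inner equivalence is symmetric in the two vertices of the product. If
  \<open>u1\<close> is outside \<open>X\<close>, then \<open>u2\<close> lies in \<open>X\<close>,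
  and the arc leaves \<open>(u1, v1)\<close> exactly when this condition fails.\<close>

lemma parcs_orientation_iff:
  "((u1, v1), (u2, v2)) \<in> parcs K \<longleftrightarrow> (u1, u2) \<in> parcs H \<and> (v1, v2) \<in> parcs G \<and>
    (u1 \<in> X \<longleftrightarrow> (u1, u2) \<in> parcs H\<tau> \<and> (v1, v2) \<in> parcs G\<sigma> \<or> (u2, u1) \<in> parcs H\<tau> \<and> (v2, v1) \<in> parcs G\<sigma>)"
proof -
  have "mk_symmetric (with_proj H\<tau>) = H" "mk_symmetric (with_proj G\<sigma>) = G"
    using H G by (simp_all add: orientation_of_def)
  moreover have "(u1, u2) \<in> parcs H \<longleftrightarrow> (u2, u1) \<in> parcs H" "(v1, v2) \<in> parcs G \<longleftrightarrow> (v2, v1) \<in> parcs G"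
    using orientation_of_parcs_iff[OF H] orientation_of_parcs_iff[OF G] by auto
  ultimately show ?thesis
    using bip_arc[of u1 u2]
    by (auto simp: kronecker_orientation_def Let_def parcs_product_iff)
qed

lemma pverts_orientation: "pverts K = pverts H \<times> pverts G"
  using orientation_of_pverts[OF H] orientation_of_pverts[OF G]
  by (simp add: kronecker_orientation_def Let_def)

lemma oriented_asym: "(u, v) \<in> parcs H\<tau> \<Longrightarrow> (v, u) \<notin> parcs H\<tau>" "(x, y) \<in> parcs G\<sigma> \<Longrightarrow> (y, x) \<notin> parcs G\<sigma>"
  using H G by (auto simp: orientation_of_def oriented_graph_def)

text \<open>Exchanging the end vertices preserves the symmetric arc condition of
  \<open>parcs_orientation_iff\<close> but flips membership of the first coordinate in
  \<open>X\<close>, so exactly one of the two directions is present on each edge. Loops are excluded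
  already in the first coordinate.\<close>

lemma orientation_of_product: "orientation_of K (kronecker_product H G)"
proof -
  note wf = orientation_of_wf[OF H] orientation_of_wf[OF G]
  have sub: "parcs K \<subseteq> (pverts H \<times> pverts G) \<times> (pverts H \<times> pverts G)"
    using wf(2,4) by (auto simp: parcs_orientation_iff)
  have "pair_digraph K"
  proof
    show "finite (pverts K)" using wf by (simp add: pverts_orientation)
    show "finite (parcs K)" using finite_subset[OF sub] wf by simp
    show "fst e \<in> pverts K" "snd e \<in> pverts K" if "e \<in> parcs K" for e
      using that sub by (auto simp: pverts_orientation)
    show "fst e \<noteq> snd e" if "e \<in> parcs K" for e
    proof -
      obtain u1 v1 u2 v2 where e: "e = ((u1, v1), (u2, v2))" by (metis prod.exhaust)
      have "u1 \<noteq> u2" using that wf(2)[of u1 u2] unfolding e parcs_orientation_iff by blast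
      then show ?thesis by (simp add: e)
    qed
  qed
  moreover have "(v, u) \<notin> parcs K" if "(u, v) \<in> parcs K" for u v
  proof -
    obtain u1 v1 u2 v2 where e: "u = (u1, v1)" "v = (u2, v2)" by (metis prod.exhaust)
    show ?thesis using that bip_arc[of u1 u2] unfolding e parcs_orientation_iff by blast
  qed
  ultimately have "oriented_graph K" by (auto simp: oriented_graph_def)
  moreover have "parcs (mk_symmetric (with_proj K)) = parcs (kronecker_product H G)"
  proof -
    have "((u1, v1), (u2, v2)) \<in> parcs (mk_symmetric (with_proj K))
        \<longleftrightarrow> ((u1, v1), (u2, v2)) \<in> parcs (kronecker_product H G)" for u1 v1 u2 v2
      using bip_arc[of u1 u2] orientation_of_parcs_iff[OF H, of u1 u2]
        orientation_of_parcs_iff[OF H, of u2 u1] orientation_of_parcs_iff[OF G, of v1 v2]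
        orientation_of_parcs_iff[OF G, of v2 v1]
      unfolding parcs_mk_symmetric_with_proj_iff parcs_orientation_iff parcs_product_iff by argo
    then show ?thesis by auto
  qed
  ultimately show ?thesis
    by (simp add: orientation_of_def pverts_product pverts_orientation)
qed

text \<open>For adjacent vertices, the arc condition of \<open>parcs_orientation_iff\<close> says
  that the entries of the two factors have equal signs, so that their product is 1. Starting outside
  \<open>X\<close> reverses the arc and thus the sign.\<close>

lemma skew_entry_orientation:
  "skew_entry K (u1, v1) (u2, v2)
    = (if u1 \<in> X then 1 else -1) * (skew_entry H\<tau> u1 u2 * skew_entry G\<sigma> v1 v2)"
proof -
  note iff = orientation_of_parcs_iff[OF H] orientation_of_parcs_iff[OF G]
  show ?thesis
    using bip_arc[of u1 u2] oriented_asym(1)[of u1 u2] oriented_asym(2)[of v1 v2]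
      oriented_asym(1)[of u2 u1] oriented_asym(2)[of v2 v1]
    unfolding skew_entry_def parcs_orientation_iff iff by auto
qed

text \<open>The neighbourhood of a pair is the Cartesian product of the neighbourhoods of its
  components.\<close>

lemma regular_product:
  assumes "regular_graph k H" "regular_graph l G"
  shows "regular_graph (k * l) (kronecker_product H G)"
proof -
  note wf = orientation_of_wf[OF H] orientation_of_wf[OF G]
  have "out_degree (with_proj (kronecker_product H G)) (u, v)
      = out_degree (with_proj H) u * out_degree (with_proj G) v" for u v
  proof -
    have "{w \<in> pverts (kronecker_product H G). ((u, v), w) \<in> parcs (kronecker_product H G)}
        = {x \<in> pverts H. (u, x) \<in> parcs H} \<times> {y \<in> pverts G. (v, y) \<in> parcs G}"
      by (auto simp: pverts_product parcs_product_iff)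
    moreover have "w \<in> pverts (kronecker_product H G)"
      if "((u, v), w) \<in> parcs (kronecker_product H G)" for w
      using that wf(2,4) by (cases w) (auto simp: pverts_product parcs_product_iff)
    ultimately show ?thesis
      using wf(2,4) by (simp add: out_degree_eq_card_neighbours card_cartesian_product)
  qed
  then show ?thesis using assms by (auto simp: regular_graph_def pverts_product)
qed

lemma bipartite_product: "bipartite_graph (kronecker_product H G)"
proof -
  \<comment> \<open>The first coordinate decides the part, since every arc of the product projects
    to an arc of \<open>H\<close>.\<close>
  have "bipartition (X \<times> pverts G) (Y \<times> pverts G) (kronecker_product H G)"
    using bip orientation_of_wf(2)[OF G]
    by (fastforce simp: bipartition_def pverts_product parcs_product_iff)
  then show ?thesis by (auto simp: bipartite_graph_def)
qed

text \<open>The inner product of two rows of the product factors, up to sign, into an inner product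
  of rows for \<open>H\<tau>\<close> and one for \<open>G\<sigma>\<close>. The criterion
  \<open>skew_energy_max_iff\<close> is used once for each factor and once, backwards, for
  \<open>K\<close>.\<close>

lemma skew_energy_orientation:
  assumes reg: "regular_graph k H" "regular_graph l G"
    and max: "skew_energy H\<tau> = real (card (pverts H)) * sqrt (real k)"
      "skew_energy G\<sigma> = real (card (pverts G)) * sqrt (real l)"
  shows "skew_energy K = real (card (pverts H) * card (pverts G)) * sqrt (real (k * l))"
proof -
  let ?P = "kronecker_product H G"
  note orth = max(1)[unfolded skew_energy_max_iff[OF H reg(1)], rule_format]
    max(2)[unfolded skew_energy_max_iff[OF G reg(2)], rule_format]
  have "(\<Sum>w\<in>pverts ?P. skew_entry K (u1, v1) w * skew_entry K (u2, v2) w)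
      = (if (u1, v1) = (u2, v2) then of_nat (k * l) else 0)"
    if "u1 \<in> pverts H" "u2 \<in> pverts H" "v1 \<in> pverts G" "v2 \<in> pverts G" for u1 u2 v1 v2
  proof -
    \<comment> \<open>The product of the signs of the two rows. It is 1 when \<open>u1 = u2\<close>;
      otherwise it multiplies the vanishing inner product of two distinct rows for
      \<open>H\<tau>\<close>.\<close>
    define c :: complex where "c = (if u1 \<in> X then 1 else -1) * (if u2 \<in> X then 1 else -1)"
    have "(\<Sum>w\<in>pverts ?P. skew_entry K (u1, v1) w * skew_entry K (u2, v2) w)
        = (\<Sum>(x, y)\<in>pverts H \<times> pverts G. c * ((skew_entry H\<tau> u1 x * skew_entry H\<tau> u2 x)
            * (skew_entry G\<sigma> v1 y * skew_entry G\<sigma> v2 y)))"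
      unfolding pverts_product
      by (intro sum.cong refl) (auto simp: skew_entry_orientation c_def)
    also have "\<dots> = c * ((\<Sum>x\<in>pverts H. skew_entry H\<tau> u1 x * skew_entry H\<tau> u2 x)
        * (\<Sum>y\<in>pverts G. skew_entry G\<sigma> v1 y * skew_entry G\<sigma> v2 y))"
      unfolding sum_product unfolding sum.cartesian_product unfolding sum_distrib_left
      by (rule sum.cong) auto
    also have "\<dots> = (if (u1, v1) = (u2, v2) then of_nat (k * l) else 0)"
      unfolding orth(1)[OF that(1,2)] orth(2)[OF that(3,4)]
      by (cases "u1 = u2"; cases "v1 = v2") (simp_all add: c_def)
    finally show ?thesis .
  qed
  then have "skew_energy K = real (card (pverts ?P)) * sqrt (real (k * l))"
    unfolding skew_energy_max_iff[OF orientation_of_product regular_product[OF reg]]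
    unfolding pverts_product by (intro ballI) (elim SigmaE, simp only:)
  then show ?thesis by (simp only: pverts_product card_cartesian_product)
qed

end

section \<open>The maximum value and the conclusion\<close>

lemma max_skew_energy_regular:
  assumes "orientation_of D G" "regular_graph d G"
  shows "max_skew_energy D = real (card (pverts G)) * sqrt (real d)"
\<comment> \<open>Without vertices the maximum degree is \<open>Max\<close> of the empty set, an
  unspecified value; the factor counting vertices makes both sides zero.\<close>
proof (cases "pverts G = {}")
  case True
  then show ?thesis using orientation_of_pverts[OF assms(1)] by (simp add: max_skew_energy_def)
next
  case False
  have "out_degree (with_proj G) ` pverts G = {d}"
    using assms(2) False by (auto simp: regular_graph_def)
  moreover have "mk_symmetric (with_proj D) = G"
    using assms(1) by (simp add: orientation_of_def)
  ultimately show ?thesis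
    using orientation_of_pverts[OF assms(1)] by (simp add: max_skew_energy_def max_degree_def)
qed

theorem theorem2p3:
  fixes H H\<tau> :: "'a pair_pre_digraph" and G G\<sigma> :: "'b pair_pre_digraph"
    and X Y :: "'a set" and k l m n :: nat
  assumes "pair_graph H" and "regular_graph k H" and "card (pverts H) = m"
    and "bipartition X Y H"
    and "orientation_of H\<tau> H" and "skew_energy H\<tau> = real m * sqrt (real k)"
    and "pair_graph G" and "regular_graph l G" and "card (pverts G) = n"
    and "orientation_of G\<sigma> G" and "skew_energy G\<sigma> = real n * sqrt (real l)"
  shows "orientation_of (kronecker_orientation X H\<tau> G\<sigma>) (kronecker_product H G) \<and>
    regular_graph (k * l) (kronecker_product H G) \<and>
    bipartite_graph (kronecker_product H G) \<and>
    skew_energy (kronecker_orientation X H\<tau> G\<sigma>)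
      = max_skew_energy (kronecker_orientation X H\<tau> G\<sigma>) \<and>
    skew_energy (kronecker_orientation X H\<tau> G\<sigma>) = real (m * n) * sqrt (real (k * l))"
proof -
  interpret oriented_kronecker_product H H\<tau> G G\<sigma> X Y
    by unfold_locales (use assms in auto)
  have energy: "skew_energy K = real (m * n) * sqrt (real (k * l))"
    using skew_energy_orientation[OF assms(2,8)] assms by simp
  moreover have "max_skew_energy K = real (m * n) * sqrt (real (k * l))"
    using max_skew_energy_regular[OF orientation_of_product regular_product[OF assms(2,8)]] assms
    by (simp add: pverts_product card_cartesian_product)
  ultimately show ?thesis
    using orientation_of_product regular_product[OF assms(2,8)] bipartite_product by simp
qed

end
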